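(* Let $\Pi$ be a group of permutations of $\{1,\dots,n\}$, let $A^0\in\{0,1\}^{n\times n}$, and let $\mathcal A=\{A^0_\pi:\pi\in\Pi\}$. Let $\mathcal E$ be a finite nonempty set of pairs $(i,j)$ and $\mathcal D\subseteq\mathbb R^k$ a finite set. Assume: (1) $A^2=f(A^1)$, where $A^1,A^2$ are adjacency matrices in $\{0,1\}^{n\times n}$; (2) both $A^1$ and $A^2$ are observed; (3) $P(A^1=A\mid f)=1/|\mathcal A|$ for all $A\in\mathcal A$; (4) for every $(i,j)\in\mathcal E$ and $d\in\mathcal D$ there is a real number $Y_{ij}^d$ (depending only on $f$) such that for all $A\in\mathcal A$, $d_{ij}(A)=d$ implies $y_{ij}(f(A))=Y_{ij}^d$; (5) $P(d_{ij}(A^1)=d)>0$ for every $(i,j)\in\mathcal E$ and every $d\in\mathcal D$; (6) $\mathcal E$ is invariant under $\Pi$: $(i,j)\in\mathcal E\Rightarrow(\pi(i),\pi(j))\in\mathcal E$ for all $\pi\in\Pi$; and $d_{ij}$ is equivariant: $d_{ij}(A_\pi)=d_{\pi(i),\pi(j)}(A)$ for all $\pi\in\Pi$, $(i,j)\in\mathcal E$, $A\in\mathcal A$. Denote $Y_{ij}=y_{ij}(A^2)$, $D_{ij}=d_{ij}(A^1)$, $p_{ij}(d)=P(D_{ij}=d)$, $P_{ij}=p_{ij}(D_{ij})$, and define $$\widehat\beta=\operatorname*{argmin}_{b}\sum_{(i,j)\in\mathcal E}\frac1{P_{ij}}\left(Y_{ij}-D_{ij}\cdot b\right)^2,$$ $$\beta=\frac1{|\mathcal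 E|}\sum_{(i,j)\in\mathcal E}\left[\left(\sum_{d\in\mathcal D}d\cdot d'\right)^{-1}\cdot\left(\sum_{d\in\mathcal D}Y_{ij}^d\cdot d\right)\right].$$ Then $E[\widehat\beta\mid f]=\beta$.
   Context: For a matrix $A$ and a permutation $\pi$, $A_\pi$ denotes the matrix with $(i,j)$ entry $A_{\pi(i),\pi(j)}$. The map $f$ on adjacency matrices may be random; $\mathcal A$, $\mathcal E$, $\mathcal D$, $d_{ij}$, $y_{ij}$ are non-random. For $(i,j)\in\mathcal E$ and $A\in\mathcal A$, $y_{ij}(f(A))$ is a real number and $d_{ij}(A)$ takes values in $\mathcal D$, the (common) theoretical support of the treatment $D_{ij}$. Elements $d\in\mathbb R^k$ are column vectors, $d'$ is the transpose, so $d\cdot d'$ is a $k\times k$ matrix; in $D_{ij}\cdot b$ with $b\in\mathbb R^k$, the dot is the inner product. The matrix $\sum_{d\in\mathcal D}d\cdot d'$ is assumed invertible. *)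

theory Defs
  imports "HOL-Probability.Probability" "HOL-Algebra.Bij"
begin

definition adj_mats :: "(real ^ 'n ^ 'n) set"
  where "adj_mats = {A. \<forall>i j. A $ i $ j \<in> {0, 1}}"

definition permute_mat :: "('n \<Rightarrow> 'n) \<Rightarrow> real ^ 'n ^ 'n \<Rightarrow> real ^ 'n ^ 'n"
  where "permute_mat \<pi> A = (\<chi> i j. A $ \<pi> i $ \<pi> j)"

text \<open>
  Maps from adjacency matrices to adjacency matrices: a finite set, because functions are
  normalised to \<^const>\<open>undefined\<close> outside \<^const>\<open>adj_mats\<close>.
\<close>

definition adj_maps :: "(real ^ 'n ^ 'n \<Rightarrow> real ^ 'n ^ 'n) set"
  where "adj_maps = adj_mats \<rightarrow>\<^sub>E adj_mats"

definition sigma_of :: "'w measure \<Rightarrow> ('w \<Rightarrow> 'b) \<Rightarrow> 'b measure \<Rightarrow> 'w measure"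
  where "sigma_of M X N = vimage_algebra (space M) X N"

definition vec_cond_exp :: "'w measure \<Rightarrow> 'w measure \<Rightarrow> ('w \<Rightarrow> real ^ 'k) \<Rightarrow> 'w \<Rightarrow> real ^ 'k"
  where "vec_cond_exp M F X = (\<lambda>\<omega>. \<chi> l. real_cond_exp M F (\<lambda>\<omega>. X \<omega> $ l) \<omega>)"

text \<open>The \<open>k \<times> k\<close> matrix \<open>d \<cdot> d'\<close>; the type \<open>1\<close> has exactly one element.\<close>

definition outer :: "real ^ 'k \<Rightarrow> real ^ 'k ^ 'k"
  where "outer d = (columnvector d :: real ^ 1 ^ 'k) ** (rowvector d :: real ^ 'k ^ 1)"

definition propensity ::
  "'w measure \<Rightarrow> ('w \<Rightarrow> 'm) \<Rightarrow> ('n \<Rightarrow> 'n \<Rightarrow> 'm \<Rightarrow> real ^ 'k) \<Rightarrow> 'n \<Rightarrow> 'n \<Rightarrow> real ^ 'k \<Rightarrow> real"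
  where "propensity M A1 d i j x = \<P>(\<omega> in M. d i j (A1 \<omega>) = x)"

definition weighted_loss ::
  "('n \<times> 'n) set \<Rightarrow> ('n \<Rightarrow> 'n \<Rightarrow> real) \<Rightarrow> ('n \<Rightarrow> 'n \<Rightarrow> real) \<Rightarrow> ('n \<Rightarrow> 'n \<Rightarrow> real ^ 'k)
    \<Rightarrow> real ^ 'k \<Rightarrow> real"
  where "weighted_loss \<E> P Y D b = (\<Sum>(i, j)\<in>\<E>. 1 / P i j * (Y i j - D i j \<bullet> b)\<^sup>2)"

definition beta_hat ::
  "'w measure \<Rightarrow> ('n \<times> 'n) set \<Rightarrow> ('n \<Rightarrow> 'n \<Rightarrow> 'm \<Rightarrow> real ^ 'k) \<Rightarrow> ('n \<Rightarrow> 'n \<Rightarrow> 'm \<Rightarrow> real)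
    \<Rightarrow> ('w \<Rightarrow> 'm) \<Rightarrow> ('w \<Rightarrow> 'm) \<Rightarrow> 'w \<Rightarrow> real ^ 'k"
  where "beta_hat M \<E> d y A1 A2 \<omega> =
    (let Y = (\<lambda>i j. y i j (A2 \<omega>));
         D = (\<lambda>i j. d i j (A1 \<omega>));
         P = (\<lambda>i j. propensity M A1 d i j (D i j))
     in arg_min (weighted_loss \<E> P Y D) (\<lambda>_. True))"

definition beta ::
  "('n \<times> 'n) set \<Rightarrow> (real ^ 'k) set \<Rightarrow> ('n \<Rightarrow> 'n \<Rightarrow> real ^ 'k \<Rightarrow> real) \<Rightarrow> real ^ 'k"
  where "beta \<E> \<D> Y =
    (1 / real (card \<E>)) *\<^sub>R
      (\<Sum>(i, j)\<in>\<E>. matrix_inv (\<Sum>d\<in>\<D>. outer d) *v (\<Sum>d\<in>\<D>. Y i j d *\<^sub>R d))"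

end

theory Submission
  imports Defs
begin

text \<open>
  Conditionally on \<open>f\<close>, \<open>A1\<close> is uniform on the orbit \<open>\<A>\<close>, so the propensity of \<open>x\<close> at \<open>(i, j)\<close>
  is the fraction of matrices in \<open>\<A>\<close> at which the treatment of \<open>(i, j)\<close> is \<open>x\<close>. By equivariance
  the weighted design matrix \<open>\<Sum> D\<^sub>i\<^sub>j D\<^sub>i\<^sub>j' / P\<^sub>i\<^sub>j\<close> is constant on the orbit, hence equal to its
  average \<open>card \<E> \<cdot> \<Sum> d d'\<close>, where the propensities cancel. The least squares estimator is therefore
  a non-random linear image of \<open>\<Sum> Y\<^sub>i\<^sub>j D\<^sub>i\<^sub>j / P\<^sub>i\<^sub>j\<close>, and averaging this vector over \<open>\<A>\<close> cancels the
  propensities once more.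
\<close>

section \<open>Outer products and matrix inverses\<close>

lemma outer_mult_vec: "outer x *v v = (x \<bullet> v) *\<^sub>R (x :: real ^ 'k)"
proof -
  have "outer x $ i $ j = x $ i * x $ j" for i j
    by (simp add: outer_def matrix_matrix_mult_def columnvector_def rowvector_def)
  then show ?thesis
    by (simp add: vec_eq_iff matrix_vector_mult_def inner_vec_def sum_distrib_left mult_ac)
qed

text \<open>This turns the design matrix applied to a vector into a sum of terms \<open>h x\<close>,
  the shape handled by the inverse frequency lemmas below.\<close>

lemma sum_outer_mult_vec:
  "(\<Sum>x\<in>D. outer x) *v v = (\<Sum>x\<in>D. (x \<bullet> v) *\<^sub>R (x :: real ^ 'k))"
  by (induction D rule: infinite_finite_induct)
    (simp_all add: matrix_vector_mult_add_rdistrib outer_mult_vec)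

lemma matrix_inv_invertible:
  assumes "invertible A"
  shows "A ** matrix_inv A = mat 1" "matrix_inv A ** A = mat 1"
  using assms someI_ex[of "\<lambda>B. A ** B = mat 1 \<and> B ** A = mat 1"]
  by (auto simp: invertible_def matrix_inv_def)

section \<open>Inverse frequency weighting and weighted least squares\<close>

text \<open>Group the sum by the value of \<open>c\<close>: a fibre of size \<open>m\<close>
  contributes \<open>m\<close> equal terms of weight \<open>card \<A> / m\<close>. Since
  \<open>c\<close> reaches every point of \<open>D\<close>, no fibre is empty and \<open>m\<close>
  cancels.\<close>

lemma sum_inverse_frequency:
  fixes h :: "'x \<Rightarrow> 'b::real_vector"
  assumes "finite \<A>" "finite D" "c \<in> \<A> \<rightarrow> D" "D \<subseteq> c ` \<A>"
  shows "(\<Sum>A\<in>\<A>. (1 / (real (card {B\<in>\<A>. c B = c A}) / real (card \<A>))) *\<^sub>R h (c A)) =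
    real (card \<A>) *\<^sub>R (\<Sum>x\<in>D. h x)"
proof -
  have "(\<Sum>A\<in>\<A>. (1 / (real (card {B\<in>\<A>. c B = c A}) / real (card \<A>))) *\<^sub>R h (c A)) =
      (\<Sum>x\<in>D. \<Sum>A | A \<in> \<A> \<and> c A = x.
        (1 / (real (card {B\<in>\<A>. c B = c A}) / real (card \<A>))) *\<^sub>R h (c A))"
    using assms by (intro sum.group[symmetric]) auto
  also have "\<dots> = (\<Sum>x\<in>D. real (card \<A>) *\<^sub>R h x)"
  proof (rule sum.cong[OF refl])
    fix x assume "x \<in> D"
    then have "card {B\<in>\<A>. c B = x} \<noteq> 0"
      using assms by auto
    moreover have "(\<Sum>A | A \<in> \<A> \<and> c A = x.
        (1 / (real (card {B\<in>\<A>. c B = c A}) / real (card \<A>))) *\<^sub>R h (c A)) =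
        (\<Sum>A | A \<in> \<A> \<and> c A = x. (1 / (real (card {B\<in>\<A>. c B = x}) / real (card \<A>))) *\<^sub>R h x)"
      by (intro sum.cong) auto
    ultimately show "(\<Sum>A | A \<in> \<A> \<and> c A = x.
        (1 / (real (card {B\<in>\<A>. c B = c A}) / real (card \<A>))) *\<^sub>R h (c A)) = real (card \<A>) *\<^sub>R h x"
      by (simp only: sum_constant_scaleR) simp
  qed
  finally show ?thesis
    by (simp add: scaleR_sum_right)
qed

text \<open>The normal equations remove the cross term, so the loss exceeds its value at
  \<open>b\<^sub>0\<close> by a quadratic form in the deviation. Definiteness makes the minimiser
  unique, which pins down \<open>arg_min\<close>, otherwise an arbitrary choice among
  minimisers.\<close>

lemma arg_min_weighted_loss:
  fixes D :: "'n \<Rightarrow> 'n \<Rightarrow> real ^ 'k"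
  assumes normal: "(\<Sum>(i, j)\<in>\<E>. (1 / P i j) *\<^sub>R ((D i j \<bullet> b\<^sub>0) *\<^sub>R D i j)) =
      (\<Sum>(i, j)\<in>\<E>. (1 / P i j) *\<^sub>R (Y i j *\<^sub>R D i j))"
    and nonneg: "\<And>i j. (i, j) \<in> \<E> \<Longrightarrow> 0 \<le> P i j"
    and definite: "\<And>v. (\<Sum>(i, j)\<in>\<E>. (1 / P i j) *\<^sub>R (D i j \<bullet> v)\<^sup>2) = 0 \<Longrightarrow> v = 0"
  shows "arg_min (weighted_loss \<E> P Y D) (\<lambda>_. True) = b\<^sub>0"
proof -
  let ?L = "weighted_loss \<E> P Y D"
  let ?q = "\<lambda>v. \<Sum>(i, j)\<in>\<E>. (1 / P i j) *\<^sub>R (D i j \<bullet> v)\<^sup>2"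
  have expand: "?L b = ?L b\<^sub>0 + ?q (b - b\<^sub>0)" for b
  proof -
    have "(\<Sum>(i, j)\<in>\<E>. (1 / P i j) *\<^sub>R ((D i j \<bullet> b\<^sub>0) *\<^sub>R D i j)) \<bullet> (b - b\<^sub>0) =
        (\<Sum>(i, j)\<in>\<E>. (1 / P i j) *\<^sub>R (Y i j *\<^sub>R D i j)) \<bullet> (b - b\<^sub>0)"
      by (simp only: normal)
    \<comment> \<open>The residual at \<open>b\<^sub>0\<close> is orthogonal to every change of the
      fit in the weighted inner product.\<close>
    then have cross: "(\<Sum>(i, j)\<in>\<E>. (1 / P i j) * (Y i j - D i j \<bullet> b\<^sub>0) * (D i j \<bullet> (b - b\<^sub>0))) = 0"
      by (simp add: inner_sum_left case_prod_unfold algebra_simps sum_subtractf sum.distrib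
          diff_divide_distrib add_divide_distrib)
    have "?L b = ?L b\<^sub>0 + ?q (b - b\<^sub>0)
        - 2 * (\<Sum>(i, j)\<in>\<E>. (1 / P i j) * (Y i j - D i j \<bullet> b\<^sub>0) * (D i j \<bullet> (b - b\<^sub>0)))"
      unfolding weighted_loss_def sum_distrib_left sum.distrib[symmetric] sum_subtractf[symmetric]
    proof (rule sum.cong[OF refl], clarify)
      fix i j
      \<comment> \<open>Used with \<open>r\<close> the outcome, \<open>s\<close> the fit at
        \<open>b\<^sub>0\<close> and \<open>t\<close> the change of the fit.\<close>
      have square: "w * (r - (s + t))\<^sup>2 = w * (r - s)\<^sup>2 + w * t\<^sup>2 - 2 * (w * (r - s) * t)"
        for w r s t :: real
        by (simp add: power2_eq_square algebra_simps)
      have "D i j \<bullet> b = D i j \<bullet> b\<^sub>0 + D i j \<bullet> (b - b\<^sub>0)"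
        by (simp add: inner_diff_right)
      then show "1 / P i j * (Y i j - D i j \<bullet> b)\<^sup>2 = 1 / P i j * (Y i j - D i j \<bullet> b\<^sub>0)\<^sup>2 +
          (1 / P i j) *\<^sub>R (D i j \<bullet> (b - b\<^sub>0))\<^sup>2
          - 2 * (1 / P i j * (Y i j - D i j \<bullet> b\<^sub>0) * (D i j \<bullet> (b - b\<^sub>0)))"
        by (simp only: real_scaleR_def square)
    qed
    with cross show ?thesis by simp
  qed
  have q_nonneg: "0 \<le> ?q v" for v
    using nonneg by (intro sum_nonneg) auto
  have least: "?L b\<^sub>0 \<le> ?L b" for b
    using expand[of b] q_nonneg[of "b - b\<^sub>0"] by linarith
  have unique: "b = b\<^sub>0" if "?L b \<le> ?L b\<^sub>0" for b
  proof -
    have "?q (b - b\<^sub>0) = 0"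
      using expand[of b] q_nonneg[of "b - b\<^sub>0"] that by linarith
    from definite[OF this] show ?thesis by simp
  qed
  show ?thesis
    unfolding arg_min_def
  proof (rule some_equality)
    show "is_arg_min ?L (\<lambda>_. True) b\<^sub>0"
      using least by (simp add: is_arg_min_linorder)
    show "b = b\<^sub>0" if "is_arg_min ?L (\<lambda>_. True) b" for b
      using that by (intro unique) (simp add: is_arg_min_linorder)
  qed
qed

section \<open>Finiteness of the value spaces\<close>

text \<open>Finiteness makes the orbit finite and every real function of \<open>A1\<close> and
  \<open>A2\<close> measurable, with no condition on \<open>d\<close> or \<open>y\<close>.\<close>

lemma finite_adj_mats: "finite (adj_mats :: (real ^ 'n ^ 'n) set)"
proof (rule finite_subset)
  show "adj_mats \<subseteq> (\<lambda>B :: 'n \<Rightarrow> 'n \<Rightarrow> real. \<chi> i j. B i j) ` (UNIV \<rightarrow>\<^sub>E (UNIV \<rightarrow>\<^sub>E {0, 1}))"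
  proof
    fix A :: "real ^ 'n ^ 'n"
    assume "A \<in> adj_mats"
    then have "(\<lambda>i j. A $ i $ j) \<in> UNIV \<rightarrow>\<^sub>E (UNIV \<rightarrow>\<^sub>E {0, 1})"
      by (auto simp: adj_mats_def PiE_iff)
    then show "A \<in> (\<lambda>B. \<chi> i j. B i j) ` (UNIV \<rightarrow>\<^sub>E (UNIV \<rightarrow>\<^sub>E {0, 1}))"
      by (rule image_eqI[where x = "\<lambda>i j. A $ i $ j", rotated]) simp
  qed
  show "finite ((\<lambda>B :: 'n \<Rightarrow> 'n \<Rightarrow> real. \<chi> i j. B i j) ` (UNIV \<rightarrow>\<^sub>E (UNIV \<rightarrow>\<^sub>E {0, 1})))"
    by (intro finite_imageI finite_PiE) auto
qed

text \<open>For a fixed matrix, a real function of the map takes finitely many values, so it is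
  bounded and hence integrable.\<close>

lemma finite_adj_maps: "finite (adj_maps :: (real ^ 'n ^ 'n \<Rightarrow> real ^ 'n ^ 'n) set)"
  unfolding adj_maps_def by (intro finite_PiE finite_adj_mats)

section \<open>Permutations acting on matrices\<close>

lemma inj_permute_mat:
  fixes \<pi> :: "'n::finite \<Rightarrow> 'n"
  assumes "surj \<pi>"
  shows "inj (permute_mat \<pi>)"
proof (rule injI)
  fix A B :: "real ^ 'n ^ 'n"
  assume "permute_mat \<pi> A = permute_mat \<pi> B"
  then have *: "A $ \<pi> i $ \<pi> j = B $ \<pi> i $ \<pi> j" for i j
    by (simp add: permute_mat_def vec_eq_iff)
  have "A $ i $ j = B $ i $ j" for i j
    using *[of "inv_into UNIV \<pi> i" "inv_into UNIV \<pi> j"] by (simp add: surj_f_inv_f[OF assms])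
  then show "A = B"
    by (simp add: vec_eq_iff)
qed

lemma bij_subgroup_BijGroup:
  assumes "subgroup G (BijGroup UNIV)" "\<pi> \<in> G"
  shows "bij \<pi>"
  using subgroup.mem_carrier[OF assms] by (simp add: BijGroup_def Bij_def)

text \<open>The product of \<open>BijGroup UNIV\<close> is a restricted composition, which agrees
  with \<open>\<circ>\<close> on bijections.\<close>

lemma comp_subgroup_BijGroup:
  assumes "subgroup G (BijGroup UNIV)" "\<pi> \<in> G" "\<rho> \<in> G"
  shows "\<pi> \<circ> \<rho> \<in> G"
proof -
  have "\<pi> \<in> Bij UNIV" "\<rho> \<in> Bij UNIV"
    using assms bij_subgroup_BijGroup by (auto simp: Bij_def)
  then show ?thesis
    using subgroup.m_closed[OF assms] by (simp add: BijGroup_def compose_def comp_def restrict_def)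
qed

text \<open>Permuting by \<open>\<rho>\<close> and then by \<open>\<pi>\<close> is permuting by
  \<open>\<rho> \<circ> \<pi>\<close>, so the orbit is mapped into itself; an injective self-map of
  a finite set is onto.\<close>

lemma bij_betw_permute_mat_orbit:
  assumes G: "subgroup G (BijGroup UNIV)" and \<pi>: "\<pi> \<in> G"
    and \<A>: "\<A> = {permute_mat \<rho> A0 | \<rho>. \<rho> \<in> G}" and fin: "finite \<A>"
  shows "bij_betw (permute_mat \<pi>) \<A> \<A>"
proof -
  have inj: "inj_on (permute_mat \<pi>) \<A>"
    using inj_permute_mat[OF bij_is_surj[OF bij_subgroup_BijGroup[OF G \<pi>]]]
    by (rule inj_on_subset) simp
  have sub: "permute_mat \<pi> ` \<A> \<subseteq> \<A>"
  proof
    fix B assume "B \<in> permute_mat \<pi> ` \<A>"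
    then obtain \<rho> where "\<rho> \<in> G" "B = permute_mat \<pi> (permute_mat \<rho> A0)"
      unfolding \<A> by blast
    moreover have "permute_mat \<pi> (permute_mat \<rho> A0) = permute_mat (\<rho> \<circ> \<pi>) A0" for \<rho>
      by (simp add: permute_mat_def vec_eq_iff)
    ultimately show "B \<in> \<A>"
      unfolding \<A> using comp_subgroup_BijGroup[OF G _ \<pi>] by blast
  qed
  show ?thesis
    unfolding bij_betw_def using inj endo_inj_surj[OF fin sub inj] by blast
qed

text \<open>By equivariance the left side does not depend on \<open>A\<close>, so it equals its
  orbit average, to which \<open>sum_inverse_frequency\<close> applies pair by pair. The codomain of
  \<open>h\<close> is general because the normal equations need vectors and definiteness needs
  scalars.\<close>

lemma inverse_frequency_sum_orbit:
  fixes A0 :: "real ^ 'n ^ 'n" and h :: "'x \<Rightarrow> 'b::real_vector"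
    and d :: "'n \<Rightarrow> 'n \<Rightarrow> real ^ 'n ^ 'n \<Rightarrow> 'x"
  assumes G: "subgroup G (BijGroup UNIV)"
    and \<A>: "\<A> = {permute_mat \<pi> A0 | \<pi>. \<pi> \<in> G}" and fin: "finite \<A>" and finD: "finite D"
    and range: "\<And>i j. (i, j) \<in> \<E> \<Longrightarrow> d i j \<in> \<A> \<rightarrow> D"
    and onto: "\<And>i j. (i, j) \<in> \<E> \<Longrightarrow> D \<subseteq> d i j ` \<A>"
    and inv: "\<And>\<pi> i j. \<pi> \<in> G \<Longrightarrow> (i, j) \<in> \<E> \<Longrightarrow> (\<pi> i, \<pi> j) \<in> \<E>"
    and equiv: "\<And>\<pi> i j A. \<pi> \<in> G \<Longrightarrow> (i, j) \<in> \<E> \<Longrightarrow> A \<in> \<A> \<Longrightarrow>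
      d i j (permute_mat \<pi> A) = d (\<pi> i) (\<pi> j) A"
    and A: "A \<in> \<A>"
  shows "(\<Sum>(i, j)\<in>\<E>. (1 / (real (card {B\<in>\<A>. d i j B = d i j A}) / real (card \<A>))) *\<^sub>R h (d i j A)) =
    real (card \<E>) *\<^sub>R (\<Sum>x\<in>D. h x)"
proof -
  let ?p = "\<lambda>i j x. real (card {B\<in>\<A>. d i j B = x}) / real (card \<A>)"
  let ?H = "\<lambda>A. \<Sum>(i, j)\<in>\<E>. (1 / ?p i j (d i j A)) *\<^sub>R h (d i j A)"
  have "id \<in> G"
    using subgroup.one_closed[OF G] by (simp add: BijGroup_def id_def restrict_def)
  then have A0: "A0 \<in> \<A>"
    unfolding \<A> by (auto simp: permute_mat_def intro!: exI[of _ id])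
  \<comment> \<open>\<open>permute_mat \<pi>\<close> maps the matrices giving
    \<open>(\<pi> i, \<pi> j)\<close> the value \<open>x\<close> bijectively onto those giving
    \<open>(i, j)\<close> the value \<open>x\<close>.\<close>
  have p_equiv: "?p (\<pi> i) (\<pi> j) x = ?p i j x" if "\<pi> \<in> G" "(i, j) \<in> \<E>" for \<pi> i j x
  proof -
    note bij = bij_betw_permute_mat_orbit[OF G that(1) \<A> fin]
    have "{B\<in>\<A>. d i j B = x} = permute_mat \<pi> ` {B\<in>\<A>. d (\<pi> i) (\<pi> j) B = x}"
      using equiv[OF that] bij_betw_imp_surj_on[OF bij] by fastforce
    moreover have "inj_on (permute_mat \<pi>) {B\<in>\<A>. d (\<pi> i) (\<pi> j) B = x}"
      using bij_betw_imp_inj_on[OF bij] by (rule inj_on_subset) auto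
    ultimately show ?thesis
      by (simp add: card_image)
  qed
  \<comment> \<open>Moving \<open>A0\<close> along its orbit merely permutes the pairs in \<open>\<E>\<close>, so \<open>?H\<close> is constant.\<close>
  have const: "?H B = ?H A0" if "B \<in> \<A>" for B
  proof -
    from that \<A> obtain \<pi> where \<pi>: "\<pi> \<in> G" "B = permute_mat \<pi> A0"
      by auto
    let ?m = "\<lambda>(i, j). (\<pi> i, \<pi> j)"
    have "inj_on ?m \<E>"
      using bij_is_inj[OF bij_subgroup_BijGroup[OF G \<pi>(1)]] by (auto simp: inj_on_def)
    moreover have "?m ` \<E> \<subseteq> \<E>"
      using inv[OF \<pi>(1)] by auto
    \<comment> \<open>The index type is finite, hence so is \<open>\<E>\<close>, and an injective
      self-map of it is onto.\<close>
    ultimately have m: "bij_betw ?m \<E> \<E>"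
      by (simp add: bij_betw_def endo_inj_surj)
    have "?H B = (\<Sum>(i, j)\<in>\<E>. (1 / ?p (\<pi> i) (\<pi> j) (d (\<pi> i) (\<pi> j) A0)) *\<^sub>R h (d (\<pi> i) (\<pi> j) A0))"
      using equiv[OF \<pi>(1) _ A0] p_equiv[OF \<pi>(1)] \<pi>(2) by (intro sum.cong) auto
    also have "\<dots> = ?H A0"
      using sum.reindex_bij_betw[OF m,
          of "\<lambda>(i, j). (1 / ?p i j (d i j A0)) *\<^sub>R h (d i j A0)"]
      by (simp add: case_prod_unfold)
    finally show ?thesis .
  qed
  have "real (card \<A>) *\<^sub>R ?H A0 = (\<Sum>B\<in>\<A>. ?H B)"
    by (subst sum.cong[OF refl const]) (simp_all add: sum_constant_scaleR)
  also have "\<dots> = (\<Sum>(i, j)\<in>\<E>. \<Sum>B\<in>\<A>. (1 / ?p i j (d i j B)) *\<^sub>R h (d i j B))"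
    by (subst sum.swap) (simp add: case_prod_unfold)
  also have "\<dots> = (\<Sum>(i, j)\<in>\<E>. real (card \<A>) *\<^sub>R (\<Sum>x\<in>D. h x))"
    using sum_inverse_frequency[OF fin finD range onto]
    by (intro sum.cong refl) (auto simp del: divide_divide_eq_right)
  also have "\<dots> = real (card \<A>) *\<^sub>R real (card \<E>) *\<^sub>R (\<Sum>x\<in>D. h x)"
    by (simp add: sum_constant_scaleR case_prod_unfold)
  \<comment> \<open>The factor \<open>card \<A>\<close> is nonzero because the orbit contains
    \<open>A0\<close>, so it cancels.\<close>
  finally have "?H A0 = real (card \<E>) *\<^sub>R (\<Sum>x\<in>D. h x)"
    using A0 fin by (auto simp del: scaleR_scaleR)
  with const[OF A] show ?thesis by simp
qed

section \<open>Conditional laws of variables with finite range\<close>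

lemma subalgebra_sigma_of:
  assumes "X \<in> measurable M N"
  shows "subalgebra M (sigma_of M X N)"
  unfolding subalgebra_def sigma_of_def
  using assms by (auto simp: sets_vimage_algebra2 measurable_space measurable_sets)

text \<open>For each value of \<open>X\<close> the expression is a function on a discrete space
  composed with \<open>Z\<close>, and finitely many such pieces are glued. \<open>K\<close> is
  arbitrary, so even the choice inside \<open>arg_min\<close> is covered.\<close>

lemma borel_measurable_finite_range2:
  fixes K :: "'a \<Rightarrow> 'b \<Rightarrow> real"
  assumes X: "X \<in> measurable M (count_space S)" and Z: "Z \<in> measurable M (count_space T)"
    and "finite S"
  shows "(\<lambda>\<omega>. K (X \<omega>) (Z \<omega>)) \<in> borel_measurable M"
proof (rule measurable_compose_countable'[OF _ X])
  show "(\<lambda>\<omega>. K s (Z \<omega>)) \<in> borel_measurable M" for s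
    using Z by (rule measurable_compose) simp
qed (use assms countable_finite in auto)

text \<open>Taking expectations in \<open>unif\<close> gives each element of \<open>\<A>\<close>
  probability \<open>1 / card \<A>\<close>; these sum to one, so \<open>X\<close> lies in
  \<open>\<A>\<close> almost surely. For the last claim, \<open>g (Z \<omega>) (X \<omega>)\<close>
  is split over the events \<open>X \<omega> = A\<close> and the factor depending on
  \<open>Z\<close> is taken out of the conditional expectation.\<close>

lemma (in prob_space) uniform_conditional_law:
  fixes X :: "'a \<Rightarrow> 'x" and Z :: "'a \<Rightarrow> 'z" and \<A> :: "'x set"
  assumes X: "X \<in> measurable M (count_space S)" and "finite S"
    and Z: "Z \<in> measurable M (count_space T)" and "finite T"
    and sub: "\<A> \<subseteq> S" and ne: "\<A> \<noteq> {}"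
    and unif: "\<And>A. A \<in> \<A> \<Longrightarrow> AE \<omega> in M. real_cond_exp M (sigma_of M Z (count_space T))
      (indicator {\<omega> \<in> space M. X \<omega> = A}) \<omega> = 1 / real (card \<A>)"
  shows "AE \<omega> in M. X \<omega> \<in> \<A>"
    and "prob {\<omega> \<in> space M. Q (X \<omega>)} = real (card {A\<in>\<A>. Q A}) / real (card \<A>)"
    and "AE \<omega> in M. real_cond_exp M (sigma_of M Z (count_space T)) (\<lambda>\<omega>. g (Z \<omega>) (X \<omega>)) \<omega> =
      (1 / real (card \<A>)) * (\<Sum>A\<in>\<A>. g (Z \<omega>) A)"
proof -
  let ?F = "sigma_of M Z (count_space T)"
  let ?I = "\<lambda>A. indicator {\<omega> \<in> space M. X \<omega> = A} :: 'a \<Rightarrow> real"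
  have fin: "finite \<A>"
    using sub \<open>finite S\<close> by (rule finite_subset)
  interpret F: finite_measure_subalgebra M ?F
    using subalgebra_sigma_of[OF Z] by unfold_locales
  have ev: "{\<omega> \<in> space M. X \<omega> = A} \<in> sets M" for A
  proof -
    have "{\<omega> \<in> space M. X \<omega> = A} = X -` ({A} \<inter> S) \<inter> space M"
      using measurable_space[OF X] by auto
    then show ?thesis
      using measurable_sets[OF X, of "{A} \<inter> S"] by simp
  qed
  have intI: "integrable M (?I A)" for A
    using ev by (simp add: integrable_indicator_iff emeasure_eq_measure)
  have prob: "prob {\<omega> \<in> space M. X \<omega> = A} = 1 / real (card \<A>)" if "A \<in> \<A>" for A
  proof -
    have "prob {\<omega> \<in> space M. X \<omega> = A} = (\<integral>\<omega>. ?I A \<omega> \<partial>M)"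
      using ev by simp
    also have "\<dots> = (\<integral>\<omega>. real_cond_exp M ?F (?I A) \<omega> \<partial>M)"
      using F.real_cond_exp_int(2)[OF intI] by simp
    also have "\<dots> = (\<integral>\<omega>. 1 / real (card \<A>) \<partial>M)"
      by (rule integral_cong_AE) (use unif[OF that] in auto)
    finally show ?thesis by (simp add: prob_space)
  qed
  have "prob (\<Union>A\<in>\<A>. {\<omega> \<in> space M. X \<omega> = A}) = (\<Sum>A\<in>\<A>. prob {\<omega> \<in> space M. X \<omega> = A})"
    using fin ev by (intro finite_measure_finite_Union) (auto simp: disjoint_family_on_def)
  also have "\<dots> = 1"
    using prob fin ne by simp
  finally have "AE \<omega> in M. \<omega> \<in> (\<Union>A\<in>\<A>. {\<omega> \<in> space M. X \<omega> = A})"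
    using AE_prob_1 by blast
  then show X_in: "AE \<omega> in M. X \<omega> \<in> \<A>"
    by eventually_elim auto
  have "prob {\<omega> \<in> space M. Q (X \<omega>)} = prob (\<Union>A\<in>{A\<in>\<A>. Q A}. {\<omega> \<in> space M. X \<omega> = A})"
  proof (rule finite_measure_eq_AE)
    show "AE \<omega> in M. (\<omega> \<in> {\<omega> \<in> space M. Q (X \<omega>)}) =
        (\<omega> \<in> (\<Union>A\<in>{A\<in>\<A>. Q A}. {\<omega> \<in> space M. X \<omega> = A}))"
      using X_in by eventually_elim auto
    have "{\<omega> \<in> space M. Q (X \<omega>)} = X -` {A\<in>S. Q A} \<inter> space M"
      using measurable_space[OF X] by auto
    then show "{\<omega> \<in> space M. Q (X \<omega>)} \<in> sets M"
      using measurable_sets[OF X, of "{A\<in>S. Q A}"] by simp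
  qed (use fin ev in auto)
  also have "\<dots> = (\<Sum>A\<in>{A\<in>\<A>. Q A}. prob {\<omega> \<in> space M. X \<omega> = A})"
    using fin ev by (intro finite_measure_finite_Union) (auto simp: disjoint_family_on_def)
  finally show "prob {\<omega> \<in> space M. Q (X \<omega>)} = real (card {A\<in>\<A>. Q A}) / real (card \<A>)"
    using prob by simp
  \<comment> \<open>Measurability for the smaller sigma-algebra is what allows this factor to be
    taken out.\<close>
  have gF: "(\<lambda>\<omega>. g (Z \<omega>) A) \<in> borel_measurable ?F" for A
  proof (rule measurable_compose[of Z])
    show "Z \<in> measurable ?F (count_space T)"
      unfolding sigma_of_def
      using Z by (intro measurable_vimage_algebra1) (auto simp: measurable_def)
  qed simp
  have int: "integrable M (\<lambda>\<omega>. g (Z \<omega>) A * ?I A \<omega>)" for A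
  proof (rule integrable_const_bound[where B = "\<Sum>z\<in>T. \<bar>g z A\<bar>"])
    show "AE \<omega> in M. norm (g (Z \<omega>) A * ?I A \<omega>) \<le> (\<Sum>z\<in>T. \<bar>g z A\<bar>)"
    proof (rule AE_I2)
      fix \<omega> assume "\<omega> \<in> space M"
      then have "Z \<omega> \<in> T"
        using Z by (auto simp: measurable_def)
      then have "\<bar>g (Z \<omega>) A\<bar> \<le> (\<Sum>z\<in>T. \<bar>g z A\<bar>)"
        using \<open>finite T\<close> by (intro member_le_sum) auto
      moreover have "norm (g (Z \<omega>) A * ?I A \<omega>) \<le> \<bar>g (Z \<omega>) A\<bar>"
        by (simp add: indicator_def)
      ultimately show "norm (g (Z \<omega>) A * ?I A \<omega>) \<le> (\<Sum>z\<in>T. \<bar>g z A\<bar>)"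
        by linarith
    qed
    show "(\<lambda>\<omega>. g (Z \<omega>) A * ?I A \<omega>) \<in> borel_measurable M"
      using measurable_from_subalg[OF F.subalg gF] ev by measurable
  qed
  have cond: "AE \<omega> in M. real_cond_exp M ?F (\<lambda>\<omega>. g (Z \<omega>) A * ?I A \<omega>) \<omega> =
      (1 / real (card \<A>)) * g (Z \<omega>) A" if "A \<in> \<A>" for A
    using F.real_cond_exp_mult[OF gF[of A] borel_measurable_integrable[OF intI[of A]] int[of A]]
      unif[OF that]
    by eventually_elim (simp only: mult.commute)
  have "AE \<omega> in M. real_cond_exp M ?F (\<lambda>\<omega>. g (Z \<omega>) (X \<omega>)) \<omega> =
      real_cond_exp M ?F (\<lambda>\<omega>. \<Sum>A\<in>\<A>. g (Z \<omega>) A * ?I A \<omega>) \<omega>"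
  proof (rule F.real_cond_exp_cong)
    show "AE \<omega> in M. g (Z \<omega>) (X \<omega>) = (\<Sum>A\<in>\<A>. g (Z \<omega>) A * ?I A \<omega>)"
      using X_in AE_space
    proof eventually_elim
      case (elim \<omega>)
      then have "(\<Sum>A\<in>\<A>. g (Z \<omega>) A * ?I A \<omega>) = (\<Sum>A\<in>\<A>. if A = X \<omega> then g (Z \<omega>) A else 0)"
        by (intro sum.cong) auto
      also have "\<dots> = g (Z \<omega>) (X \<omega>)"
        using elim fin by simp
      finally show ?case by simp
    qed
    show "(\<lambda>\<omega>. g (Z \<omega>) (X \<omega>)) \<in> borel_measurable M"
      using borel_measurable_finite_range2[OF Z X \<open>finite T\<close>] .
    show "(\<lambda>\<omega>. \<Sum>A\<in>\<A>. g (Z \<omega>) A * ?I A \<omega>) \<in> borel_measurable M"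
      using int by (intro borel_measurable_sum borel_measurable_integrable)
  qed
  moreover have "AE \<omega> in M. real_cond_exp M ?F (\<lambda>\<omega>. \<Sum>A\<in>\<A>. g (Z \<omega>) A * ?I A \<omega>) \<omega> =
      (\<Sum>A\<in>\<A>. real_cond_exp M ?F (\<lambda>\<omega>. g (Z \<omega>) A * ?I A \<omega>) \<omega>)"
    by (rule F.real_cond_exp_sum[OF int])
  moreover have "AE \<omega> in M. \<forall>A\<in>\<A>. real_cond_exp M ?F (\<lambda>\<omega>. g (Z \<omega>) A * ?I A \<omega>) \<omega> =
      (1 / real (card \<A>)) * g (Z \<omega>) A"
    using cond fin by (simp add: AE_finite_all)
  ultimately show "AE \<omega> in M. real_cond_exp M ?F (\<lambda>\<omega>. g (Z \<omega>) (X \<omega>)) \<omega> =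
      (1 / real (card \<A>)) * (\<Sum>A\<in>\<A>. g (Z \<omega>) A)"
    by eventually_elim (simp add: sum_distrib_left)
qed

section \<open>Unbiasedness of the estimator\<close>

text \<open>\<open>Y\<close> takes the map \<open>f \<omega>\<close> as an argument, which expresses
  that potential outcomes depend on \<open>f\<close> alone. Conditioning is on the sigma-algebra
  generated by \<open>f\<close>, so the equality holds almost surely.\<close>

theorem proposition1:
  fixes M :: "'w measure"
    and G :: "('n::finite \<Rightarrow> 'n) set"
    and A0 :: "real ^ 'n ^ 'n"
    and \<A> :: "(real ^ 'n ^ 'n) set"
    and \<E> :: "('n \<times> 'n) set"
    and \<D> :: "(real ^ 'k) set"
    and f :: "'w \<Rightarrow> real ^ 'n ^ 'n \<Rightarrow> real ^ 'n ^ 'n"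
    and A1 A2 :: "'w \<Rightarrow> real ^ 'n ^ 'n"
    and d :: "'n \<Rightarrow> 'n \<Rightarrow> real ^ 'n ^ 'n \<Rightarrow> real ^ 'k"
    and y :: "'n \<Rightarrow> 'n \<Rightarrow> real ^ 'n ^ 'n \<Rightarrow> real"
    and Y :: "(real ^ 'n ^ 'n \<Rightarrow> real ^ 'n ^ 'n) \<Rightarrow> 'n \<Rightarrow> 'n \<Rightarrow> real ^ 'k \<Rightarrow> real"
  defines "\<A> \<equiv> {permute_mat \<pi> A0 | \<pi>. \<pi> \<in> G}"
    and "\<F> \<equiv> sigma_of M f (count_space adj_maps)"
  assumes "prob_space M"
    and "subgroup G (BijGroup UNIV)"
    and "A0 \<in> adj_mats"
    and "\<E> \<noteq> {}"
    and "finite \<D>"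
    and "invertible (\<Sum>x\<in>\<D>. outer x)"
    and "f \<in> measurable M (count_space adj_maps)"
    and "A1 \<in> measurable M (count_space adj_mats)"
    and "A2 \<in> measurable M (count_space adj_mats)"
    and "\<And>i j A. (i, j) \<in> \<E> \<Longrightarrow> A \<in> \<A> \<Longrightarrow> d i j A \<in> \<D>"
    and "AE \<omega> in M. A2 \<omega> = f \<omega> (A1 \<omega>)"
    and "\<And>A. A \<in> \<A> \<Longrightarrow>
      AE \<omega> in M. real_cond_exp M \<F> (indicator {\<omega> \<in> space M. A1 \<omega> = A}) \<omega> = 1 / real (card \<A>)"
    and "AE \<omega> in M. \<forall>(i, j)\<in>\<E>. \<forall>x\<in>\<D>. \<forall>A\<in>\<A>. d i j A = x \<longrightarrow> y i j (f \<omega> A) = Y (f \<omega>) i j x"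
    and "\<And>i j x. (i, j) \<in> \<E> \<Longrightarrow> x \<in> \<D> \<Longrightarrow> \<P>(\<omega> in M. d i j (A1 \<omega>) = x) > 0"
    and "\<And>\<pi> i j. \<pi> \<in> G \<Longrightarrow> (i, j) \<in> \<E> \<Longrightarrow> (\<pi> i, \<pi> j) \<in> \<E>"
    and "\<And>\<pi> i j A. \<pi> \<in> G \<Longrightarrow> (i, j) \<in> \<E> \<Longrightarrow> A \<in> \<A> \<Longrightarrow>
      d i j (permute_mat \<pi> A) = d (\<pi> i) (\<pi> j) A"
  shows "AE \<omega> in M. vec_cond_exp M \<F> (beta_hat M \<E> d y A1 A2) \<omega> = beta \<E> \<D> (Y (f \<omega>))"
proof -
  interpret prob_space M by fact
  note G = assms(4) and fin_D = assms(7) and invS = assms(8)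
    and f_meas = assms(9) and A1_meas = assms(10) and A2_meas = assms(11)
    and d_in = assms(12) and unif = assms(14) and pos = assms(16)
    and inv = assms(17) and equiv = assms(18)
  let ?S = "\<Sum>x\<in>\<D>. outer x"
  let ?p = "\<lambda>i j x. real (card {A\<in>\<A>. d i j A = x}) / real (card \<A>)"
  have \<A>_sub: "\<A> \<subseteq> adj_mats"
  proof
    fix A assume "A \<in> \<A>"
    then obtain \<pi> where "A = permute_mat \<pi> A0"
      unfolding \<A>_def by blast
    moreover have "A0 $ i $ j \<in> {0, 1}" for i j
      using assms(5) unfolding adj_mats_def by blast
    ultimately show "A \<in> adj_mats"
      by (simp add: adj_mats_def permute_mat_def)
  qed
  then have fin_A: "finite \<A>"
    by (rule finite_subset) (rule finite_adj_mats)
  have \<A>_ne: "\<A> \<noteq> {}"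
    using subgroup.one_closed[OF G] unfolding \<A>_def by auto
  have card_A: "real (card \<A>) \<noteq> 0"
    using fin_A \<A>_ne by simp
  have card_E: "real (card \<E>) \<noteq> 0"
    using \<open>\<E> \<noteq> {}\<close> by simp
  note law = uniform_conditional_law[OF A1_meas finite_adj_mats f_meas finite_adj_maps
      \<A>_sub \<A>_ne unif[unfolded \<F>_def], folded \<F>_def]
  have A1_in: "AE \<omega> in M. A1 \<omega> \<in> \<A>"
    by (rule law(1))
  \<comment> \<open>The conditional law of \<open>A1\<close> is the same constant for almost every
    outcome, so the unconditional propensity is the orbit frequency.\<close>
  have propensity: "propensity M A1 d i j x = ?p i j x" for i j x
    unfolding propensity_def by (rule law(2)[of "\<lambda>A. d i j A = x"])
  \<comment> \<open>A positive propensity forces the treatment to occur somewhere on the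
    orbit.\<close>
  have onto: "\<D> \<subseteq> d i j ` \<A>" if "(i, j) \<in> \<E>" for i j
  proof
    fix x assume "x \<in> \<D>"
    from pos[OF that this] have "{A\<in>\<A>. d i j A = x} \<noteq> {}"
      using propensity[of i j x] unfolding propensity_def by (auto simp del: Collect_empty_eq)
    then show "x \<in> d i j ` \<A>" by auto
  qed
  have range: "d i j \<in> \<A> \<rightarrow> \<D>" if "(i, j) \<in> \<E>" for i j
    using d_in[OF that] by auto
  have orbit_sum: "(\<Sum>(i, j)\<in>\<E>. (1 / ?p i j (d i j A)) *\<^sub>R h (d i j A)) =
      real (card \<E>) *\<^sub>R (\<Sum>x\<in>\<D>. h x)" if "A \<in> \<A>" for A and h :: "real ^ 'k \<Rightarrow> real ^ 'k"
    by (rule inverse_frequency_sum_orbit[OF G \<A>_def[THEN meta_eq_to_obj_eq] fin_A fin_D])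
      (fact range onto inv equiv that)+
  \<comment> \<open>The scalar instance serves the quadratic form, with
    \<open>h x = (x \<bullet> v)\<^sup>2\<close>.\<close>
  have orbit_sum_real: "(\<Sum>(i, j)\<in>\<E>. (1 / ?p i j (d i j A)) *\<^sub>R h (d i j A)) =
      real (card \<E>) *\<^sub>R (\<Sum>x\<in>\<D>. h x)" if "A \<in> \<A>" for A and h :: "real ^ 'k \<Rightarrow> real"
    by (rule inverse_frequency_sum_orbit[OF G \<A>_def[THEN meta_eq_to_obj_eq] fin_A fin_D])
      (fact range onto inv equiv that)+
  have S_inv: "?S *v (matrix_inv ?S *v w) = w" for w
    using invS by (simp add: matrix_vector_mul_assoc matrix_inv_invertible)
  have inv_S: "matrix_inv ?S *v (?S *v w) = w" for w
    using invS by (simp add: matrix_vector_mul_assoc matrix_inv_invertible)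
  \<comment> \<open>This solves the normal equations for the design matrix \<open>card \<E>\<close>
    times \<open>?S\<close>. Outcomes enter through \<open>Y \<phi>\<close>, so \<open>g\<close> is
    a non-random function of map and matrix.\<close>
  define g where "g \<phi> A = matrix_inv ?S *v ((1 / real (card \<E>)) *\<^sub>R
    (\<Sum>(i, j)\<in>\<E>. (1 / ?p i j (d i j A)) *\<^sub>R (Y \<phi> i j (d i j A) *\<^sub>R d i j A)))" for \<phi> A
  have beta_hat: "AE \<omega> in M. beta_hat M \<E> d y A1 A2 \<omega> = g (f \<omega>) (A1 \<omega>)"
    using A1_in assms(13) assms(15)
  proof eventually_elim
    case (elim \<omega>)
    let ?A = "A1 \<omega>"
    \<comment> \<open>The observed outcome is the potential outcome at the realised
      treatment.\<close>
    have Y: "y i j (A2 \<omega>) = Y (f \<omega>) i j (d i j ?A)" if "(i, j) \<in> \<E>" for i j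
      using elim d_in[OF that elim(1)] that by fastforce
    show ?case
      unfolding beta_hat_def Let_def propensity
    proof (rule arg_min_weighted_loss)
      have "(\<Sum>(i, j)\<in>\<E>. (1 / ?p i j (d i j ?A)) *\<^sub>R
          ((d i j ?A \<bullet> g (f \<omega>) ?A) *\<^sub>R d i j ?A)) = real (card \<E>) *\<^sub>R (?S *v g (f \<omega>) ?A)"
        using orbit_sum[OF elim(1), of "\<lambda>x. (x \<bullet> g (f \<omega>) ?A) *\<^sub>R x"]
        by (simp add: sum_outer_mult_vec)
      also have "\<dots> = (\<Sum>(i, j)\<in>\<E>. (1 / ?p i j (d i j ?A)) *\<^sub>R
          (Y (f \<omega>) i j (d i j ?A) *\<^sub>R d i j ?A))"
        unfolding g_def S_inv using card_E by simp
      also have "\<dots> = (\<Sum>(i, j)\<in>\<E>. (1 / ?p i j (d i j ?A)) *\<^sub>R (y i j (A2 \<omega>) *\<^sub>R d i j ?A))"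
        using Y by (intro sum.cong) auto
      finally show "(\<Sum>(i, j)\<in>\<E>. (1 / ?p i j (d i j ?A)) *\<^sub>R
          ((d i j ?A \<bullet> g (f \<omega>) ?A) *\<^sub>R d i j ?A)) = \<dots>" .
    next
      fix v
      assume "(\<Sum>(i, j)\<in>\<E>. (1 / ?p i j (d i j ?A)) *\<^sub>R (d i j ?A \<bullet> v)\<^sup>2) = 0"
      then have "(\<Sum>x\<in>\<D>. (x \<bullet> v)\<^sup>2) = 0"
        using orbit_sum_real[OF elim(1), of "\<lambda>x. (x \<bullet> v)\<^sup>2"] card_E by simp
      then have "\<forall>x\<in>\<D>. x \<bullet> v = 0"
        using fin_D by (simp add: sum_nonneg_eq_0_iff)
      \<comment> \<open>A vector orthogonal to all of \<open>\<D>\<close> lies in the kernel of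
        \<open>?S\<close>, which is trivial by invertibility.\<close>
      then have "?S *v v = 0"
        by (simp add: sum_outer_mult_vec)
      then show "v = 0"
        using inv_S[of v] by simp
    qed simp
  qed
  \<comment> \<open>Here the summand depends on the pair through \<open>Y\<close>, so the sum may
    vary along the orbit and \<open>orbit_sum\<close> does not apply; averaging over the orbit
    cancels the propensities for each pair separately.\<close>
  have mean_g: "(1 / real (card \<A>)) *\<^sub>R (\<Sum>A\<in>\<A>. g \<phi> A) = beta \<E> \<D> (Y \<phi>)" for \<phi>
  proof -
    have "(\<Sum>A\<in>\<A>. \<Sum>(i, j)\<in>\<E>. (1 / ?p i j (d i j A)) *\<^sub>R (Y \<phi> i j (d i j A) *\<^sub>R d i j A)) =
        (\<Sum>(i, j)\<in>\<E>. \<Sum>A\<in>\<A>. (1 / ?p i j (d i j A)) *\<^sub>R (Y \<phi> i j (d i j A) *\<^sub>R d i j A))"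
      by (subst sum.swap) (simp add: case_prod_unfold)
    also have "\<dots> = (\<Sum>(i, j)\<in>\<E>. real (card \<A>) *\<^sub>R (\<Sum>x\<in>\<D>. Y \<phi> i j x *\<^sub>R x))"
    proof (rule sum.cong[OF refl], clarify)
      fix i j assume "(i, j) \<in> \<E>"
      then show "(\<Sum>A\<in>\<A>. (1 / ?p i j (d i j A)) *\<^sub>R (Y \<phi> i j (d i j A) *\<^sub>R d i j A)) =
          real (card \<A>) *\<^sub>R (\<Sum>x\<in>\<D>. Y \<phi> i j x *\<^sub>R x)"
        using sum_inverse_frequency[where c = "d i j" and D = \<D>, OF fin_A fin_D range onto,
            where h = "\<lambda>x. Y \<phi> i j x *\<^sub>R x"]
        by blast
    qed
    also have "\<dots> = real (card \<A>) *\<^sub>R (\<Sum>(i, j)\<in>\<E>. \<Sum>x\<in>\<D>. Y \<phi> i j x *\<^sub>R x)"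
      by (simp add: scaleR_sum_right case_prod_unfold)
    finally have *: "(\<Sum>A\<in>\<A>. \<Sum>(i, j)\<in>\<E>. (1 / ?p i j (d i j A)) *\<^sub>R (Y \<phi> i j (d i j A) *\<^sub>R d i j A)) =
        real (card \<A>) *\<^sub>R (\<Sum>(i, j)\<in>\<E>. \<Sum>x\<in>\<D>. Y \<phi> i j x *\<^sub>R x)" .
    have lin: "linear ((*v) (matrix_inv ?S))"
      by (rule matrix_vector_mul_linear)
    have "(\<Sum>A\<in>\<A>. g \<phi> A) = (1 / real (card \<E>)) *\<^sub>R (matrix_inv ?S *v
        (\<Sum>A\<in>\<A>. \<Sum>(i, j)\<in>\<E>. (1 / ?p i j (d i j A)) *\<^sub>R (Y \<phi> i j (d i j A) *\<^sub>R d i j A)))"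
      unfolding g_def by (simp only: linear_sum[OF lin] linear_cmul[OF lin] scaleR_sum_right)
    then show ?thesis
      unfolding * beta_def
      using card_A by (simp add: linear_sum[OF lin] linear_cmul[OF lin] case_prod_unfold)
  qed
  have "AE \<omega> in M. real_cond_exp M \<F> (\<lambda>\<omega>. beta_hat M \<E> d y A1 A2 \<omega> $ l) \<omega> =
      beta \<E> \<D> (Y (f \<omega>)) $ l" for l
  proof -
    interpret F: finite_measure_subalgebra M \<F>
      unfolding \<F>_def using subalgebra_sigma_of[OF f_meas] by unfold_locales
    have mean: "(1 / real (card \<A>)) * (\<Sum>A\<in>\<A>. g \<phi> A $ l) = beta \<E> \<D> (Y \<phi>) $ l" for \<phi>
      unfolding mean_g[symmetric] by simp
    have "AE \<omega> in M. real_cond_exp M \<F> (\<lambda>\<omega>. beta_hat M \<E> d y A1 A2 \<omega> $ l) \<omega> =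
        real_cond_exp M \<F> (\<lambda>\<omega>. g (f \<omega>) (A1 \<omega>) $ l) \<omega>"
    proof (rule F.real_cond_exp_cong)
      show "AE \<omega> in M. beta_hat M \<E> d y A1 A2 \<omega> $ l = g (f \<omega>) (A1 \<omega>) $ l"
        using beta_hat by eventually_elim simp
      show "(\<lambda>\<omega>. g (f \<omega>) (A1 \<omega>) $ l) \<in> borel_measurable M"
        by (rule borel_measurable_finite_range2[OF f_meas A1_meas finite_adj_maps])
      \<comment> \<open>The estimator depends on the outcome only through \<open>A1\<close> and
        \<open>A2\<close>, both finitely valued.\<close>
      show "(\<lambda>\<omega>. beta_hat M \<E> d y A1 A2 \<omega> $ l) \<in> borel_measurable M"
        unfolding beta_hat_def
        by (rule borel_measurable_finite_range2[OF A1_meas A2_meas finite_adj_mats])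
    qed
    moreover have "AE \<omega> in M. real_cond_exp M \<F> (\<lambda>\<omega>. g (f \<omega>) (A1 \<omega>) $ l) \<omega> =
        (1 / real (card \<A>)) * (\<Sum>A\<in>\<A>. g (f \<omega>) A $ l)"
      by (rule law(3)) simp
    ultimately show ?thesis
      by eventually_elim (simp only: mean)
  qed
  then have "AE \<omega> in M. \<forall>l. real_cond_exp M \<F> (\<lambda>\<omega>. beta_hat M \<E> d y A1 A2 \<omega> $ l) \<omega> =
      beta \<E> \<D> (Y (f \<omega>)) $ l"
    by (rule eventually_all_finite)
  then show ?thesis
    unfolding vec_cond_exp_def by eventually_elim (simp add: vec_eq_iff)
qed

end
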